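(* Let $\{a_n\}_{n\in\mathbb{N}}$ be an increasing sequence of real numbers such that $a_n \to \infty$ and $a_{n+1}-a_n \to 0$ as $n\to\infty$. Let $f : \mathbb{R}\to\mathbb{R}$ be a continuous function such that the limit $\lim_{n\to\infty} f(x+a_n)$ exists in $\mathbb{R}$ for every $x \in \mathbb{R}$. Then the limit $\lim_{x\to\infty} f(x)$ also exists in $\mathbb{R}$.
   Context: Here $\mathbb{N}=\{1,2,\ldots\}$, and "the limit exists" means that it exists as a finite real number. The limits $\lim_{n\to\infty} f(x+a_n)$ are not assumed to be equal for different $x$. *)

theory Defs
  imports Complex_Main
begin

end

theory Submission
  imports Defs "HOL-Analysis.Elementary_Normed_Spaces"
begin

text \<open>
  The functions \<open>x \<mapsto> f (x + a n)\<close> are continuous and converge pointwise, so the Baire category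
  theorem makes them, for each \<open>\<epsilon> > 0\<close>, uniformly Cauchy up to \<open>\<epsilon>\<close> on some ball around a point \<open>c\<close>
  (lemma \<open>pointwise_Cauchy_imp_locally_almost_constant\<close>): there \<open>f (x + a n)\<close> is \<open>\<epsilon>\<close>-close to
  \<open>f (x + a N)\<close> for all \<open>n \<ge> N\<close>.
  Since the single function \<open>x \<mapsto> f (x + a N)\<close> is continuous at \<open>c\<close>, shrinking the ball makes all
  the values \<open>f (x + a n)\<close> with \<open>n \<ge> N\<close> and \<open>x\<close> in the ball \<open>2 \<epsilon>\<close>-close to the one number
  \<open>f (c + a N)\<close>.  The gaps of \<open>a\<close> eventually become smaller than the radius of the ball, so its
  translates by the \<open>a n\<close> with \<open>n \<ge> N\<close> cover a neighbourhood of infinity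
  (lemma \<open>small_gaps_imp_close_below\<close>).  Hence \<open>f\<close> oscillates by at most \<open>4 \<epsilon>\<close> near infinity,
  and the limit exists by completeness.
\<close>

lemma countable_closed_cover_interior:
  fixes E :: "nat \<Rightarrow> 'a :: {real_normed_vector, heine_borel} set"
  assumes "\<And>n. closed (E n)" "(\<Union>n. E n) = UNIV"
  obtains n where "interior (E n) \<noteq> {}"
proof (rule ccontr)
  assume "\<not> thesis"
  then have "interior (E n) = {}" for n
    using that by blast
  then have "UNIV \<subseteq> closure (\<Inter>(range (\<lambda>n. - E n)))"
    using assms(1) by (intro Baire) (auto simp: closure_complement)
  moreover have "\<Inter>(range (\<lambda>n. - E n)) = {}"
    using assms(2) by blast
  ultimately show False
    by simp
qed

text \<open>
  The sets of points at which \<open>g\<close> stays within \<open>\<epsilon>\<close> of \<open>g N\<close> from index \<open>N\<close> on are closed and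
  cover the space, so one of them has interior points.
\<close>
lemma pointwise_Cauchy_imp_locally_almost_constant:
  fixes g :: "nat \<Rightarrow> 'a :: {real_normed_vector, heine_borel} \<Rightarrow> 'b :: metric_space"
  assumes cont: "\<And>n. continuous_on UNIV (g n)"
    and Cauchy: "\<And>x. Cauchy (\<lambda>n. g n x)"
    and "\<epsilon> > 0"
  obtains N c r where "r > 0"
    "\<And>x n. x \<in> ball c r \<Longrightarrow> n \<ge> N \<Longrightarrow> dist (g n x) (g N x) \<le> \<epsilon>"
proof -
  define E where "E N = (\<Inter>n\<in>{N..}. {x. dist (g n x) (g N x) \<le> \<epsilon>})" for N
  have "closed (E N)" for N
    unfolding E_def by (intro closed_INT ballI closed_Collect_le continuous_intros cont)
  moreover have "(\<Union>N. E N) = UNIV"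
  proof -
    have "\<exists>N. x \<in> E N" for x
      using metric_CauchyD[OF Cauchy \<open>\<epsilon> > 0\<close>, of x] by (force simp: E_def)
    then show ?thesis by blast
  qed
  ultimately obtain N where "interior (E N) \<noteq> {}"
    by (rule countable_closed_cover_interior)
  then obtain c r where "r > 0" "ball c r \<subseteq> E N"
    by (auto simp: mem_interior)
  then show ?thesis
    by (intro that[of r c N]) (auto simp: E_def subset_iff)
qed

lemma small_gaps_imp_close_below:
  fixes a :: "nat \<Rightarrow> real"
  assumes "filterlim a at_top sequentially"
    and "(\<lambda>n. a (Suc n) - a n) \<longlonglongrightarrow> 0"
    and "\<delta> > 0"
  shows "\<forall>\<^sub>F y in at_top. \<exists>n\<ge>N. a n \<le> y \<and> y < a n + \<delta>"
proof -
  obtain K where K: "\<And>n. n \<ge> K \<Longrightarrow> \<bar>a (Suc n) - a n\<bar> < \<delta>"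
    using LIMSEQ_D[OF assms(2,3)] by auto
  define M where "M = max K N"
  have "\<exists>n\<ge>N. a n \<le> y \<and> y < a n + \<delta>" if y: "y \<ge> a M" for y
  proof -
    \<comment> \<open>The first index from \<open>M\<close> on at which \<open>a\<close> exceeds \<open>y\<close> is not \<open>M\<close> itself; take its predecessor.\<close>
    define P where "P = (\<lambda>m. m \<ge> M \<and> a m > y)"
    have "\<forall>\<^sub>F m in sequentially. m \<ge> M \<and> a m > y"
      using assms(1) by (intro eventually_conj eventually_ge_at_top)
        (simp add: filterlim_at_top_dense)
    then have ex: "\<exists>m. P m"
      unfolding P_def by (auto simp: eventually_sequentially)
    define m where "m = (LEAST m. P m)"
    have m: "m \<ge> M" "a m > y"
      using LeastI_ex[OF ex] by (auto simp: m_def P_def)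
    then have "m \<noteq> M" using y by auto
    then obtain n where n: "m = Suc n" "n \<ge> M"
      using m(1) by (cases m) auto
    have "\<not> P n"
      by (rule not_less_Least) (use n m_def in auto)
    then have "a n \<le> y" using n by (auto simp: P_def)
    moreover have "y < a n + \<delta>"
      using m(2) K[of n] n by (auto simp: M_def)
    ultimately show ?thesis using n by (auto simp: M_def)
  qed
  then show ?thesis
    unfolding eventually_at_top_linorder by blast
qed

theorem mainTheorem8:
  fixes a :: "nat \<Rightarrow> real" and f :: "real \<Rightarrow> real"
  assumes "incseq a"
    and "filterlim a at_top sequentially"
    and "(\<lambda>n. a (Suc n) - a n) \<longlonglongrightarrow> 0"
    and "continuous_on UNIV f"
    and "\<And>x. \<exists>l. (\<lambda>n. f (x + a n)) \<longlonglongrightarrow> l"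
  shows "\<exists>L. (f \<longlongrightarrow> L) at_top"
proof -
  have near: "\<exists>C. \<forall>\<^sub>F y in at_top. dist (f y) C \<le> 2 * \<epsilon>" if "\<epsilon> > 0" for \<epsilon> :: real
  proof -
    have cont: "continuous_on UNIV (\<lambda>x. f (x + a n))" for n
      by (rule continuous_on_compose2[OF assms(4)]) (auto intro: continuous_intros)
    obtain N c r where "r > 0" and
      N: "\<And>x n. x \<in> ball c r \<Longrightarrow> n \<ge> N \<Longrightarrow> dist (f (x + a n)) (f (x + a N)) \<le> \<epsilon>"
      using pointwise_Cauchy_imp_locally_almost_constant[of "\<lambda>n x. f (x + a n)" \<epsilon>]
        cont assms(5) \<open>\<epsilon> > 0\<close> by (metis LIMSEQ_imp_Cauchy)
    obtain s where "s > 0" and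
      s: "\<And>x. dist x c < s \<Longrightarrow> dist (f (x + a N)) (f (c + a N)) < \<epsilon>"
      using cont[of N] \<open>\<epsilon> > 0\<close> unfolding continuous_on_iff by (metis UNIV_I)
    define \<delta> where "\<delta> = min r s"
    have "\<delta> > 0" using \<open>r > 0\<close> \<open>s > 0\<close> by (simp add: \<delta>_def)
    have "\<forall>\<^sub>F z in at_top. \<exists>n\<ge>N. a n \<le> z \<and> z < a n + \<delta>"
      by (rule small_gaps_imp_close_below[OF assms(2,3) \<open>\<delta> > 0\<close>])
    then obtain Z where Z: "\<And>z. z \<ge> Z \<Longrightarrow> \<exists>n\<ge>N. a n \<le> z \<and> z < a n + \<delta>"
      by (auto simp: eventually_at_top_linorder)
    have "dist (f y) (f (c + a N)) \<le> 2 * \<epsilon>" if y: "y \<ge> Z + c" for y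
    proof -
      obtain n where n: "n \<ge> N" "a n \<le> y - c" "y - c < a n + \<delta>"
        using Z[of "y - c"] y by auto
      define x where "x = y - a n"
      have x: "dist x c < \<delta>"
        using n by (auto simp: x_def dist_real_def)
      have "dist (f (x + a n)) (f (x + a N)) \<le> \<epsilon>"
        using N[of x n] n x by (auto simp: \<delta>_def dist_commute)
      moreover have "dist (f (x + a N)) (f (c + a N)) < \<epsilon>"
        using s x by (auto simp: \<delta>_def)
      ultimately show ?thesis
        using dist_triangle[of "f y" "f (c + a N)" "f (x + a N)"] by (simp add: x_def)
    qed
    then show ?thesis
      unfolding eventually_at_top_linorder by blast
  qed
  have "cauchy_filter (filtermap f at_top)"
    unfolding cauchy_filter_metric_filtermap
  proof (intro allI impI)
    fix e :: real
    assume "e > 0"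
    then obtain C where C: "\<forall>\<^sub>F y in at_top. dist (f y) C \<le> 2 * (e / 5)"
      using near[of "e / 5"] by auto
    have "dist (f x) (f y) < e" if "dist (f x) C \<le> 2 * (e / 5)" "dist (f y) C \<le> 2 * (e / 5)" for x y
      using that dist_triangle2[of "f x" "f y" C] \<open>e > 0\<close> by simp
    with C show "\<exists>P. eventually P at_top \<and> (\<forall>x y. P x \<and> P y \<longrightarrow> dist (f x) (f y) < e)"
      by blast
  qed
  then obtain L where "filtermap f at_top \<le> nhds L"
    using cauchy_filter_complete_converges[of "filtermap f at_top" UNIV] complete_UNIV
    by (auto simp: filtermap_bot_iff)
  then show ?thesis
    by (auto simp: filterlim_def)
qed

end
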